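(* Let $N$ and $N'$ be positive integers ($N\neq 0$) and let $a,b,d$ be complex parameters. Then $$F_{1:1}^{0:3}\left[{-\atop d}:{a,b,-N\atop 1+a+b-N-d};{d-a,d-b,-N'\atop 1-N-N'};1,1\right]=\frac{(d-a,\,d-b)_{N+N'}}{(d)_{N+N'}\,(d-a-b)_N\,(N)_{N'}}.$$
   Context: $(x)_m=x(x+1)\cdots(x+m-1)$, $(x)_0=1$, is the Pochhammer symbol, and $(x_1,\dots,x_r)_m=(x_1)_m\cdots(x_r)_m$. The Kampé de Fériet series is $$F_{1:1}^{0:3}\left[{-\atop d}:{a,b,c\atop e};{a',b',c'\atop e'};x,y\right]=\sum_{m,n}\frac{(a,b,c)_m(a',b',c')_n}{(d)_{m+n}(e)_m(e')_n}\frac{x^my^n}{m!\,n!},$$ with $m,n$ running over the nonnegative integers. In the claim, because of the numerator parameters $-N$ and $-N'$, it is the finite sum over $0\le m\le N$, $0\le n\le N'$; in this range $(1-N-N')_n\neq0$, so all terms are well defined. It is understood that the other denominator parameters $d$ and $1+a+b-N-d$ are not zero or negative integers. *)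

theory Defs
  imports "HOL-Analysis.Infinite_Sum" "HOL-Library.Nonpos_Ints"
begin

definition kdf_term ::
  "complex \<Rightarrow> complex \<Rightarrow> complex \<Rightarrow> complex \<Rightarrow> complex \<Rightarrow>
   complex \<Rightarrow> complex \<Rightarrow> complex \<Rightarrow> complex \<Rightarrow> complex \<Rightarrow> complex \<Rightarrow> nat \<Rightarrow> nat \<Rightarrow> complex"
  where
  "kdf_term d a b c e a' b' c' e' x y m n =
     (pochhammer a m * pochhammer b m * pochhammer c m *
      (pochhammer a' n * pochhammer b' n * pochhammer c' n)) /
     (pochhammer d (m + n) * pochhammer e m * pochhammer e' n) *
     (x ^ m * y ^ n / (fact m * fact n))"

(* The argument order follows the bracket notation
     F^{0:3}_{1:1} [ - / d : a, b, c / e ; a', b', c' / e' ; x, y ].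
   A terminating series may have a denominator parameter e' that is a nonpositive integer,
   provided that the factor pochhammer e' n first vanishes beyond the range of summation.
   Beyond that range the numerator is 0, so the terms are 0 (also as 0 / 0 = 0), and the sum
   is the finite one: see kampe_de_feriet_terminating. *)
definition kampe_de_feriet ::
  "complex \<Rightarrow> complex \<Rightarrow> complex \<Rightarrow> complex \<Rightarrow> complex \<Rightarrow>
   complex \<Rightarrow> complex \<Rightarrow> complex \<Rightarrow> complex \<Rightarrow> complex \<Rightarrow> complex \<Rightarrow> complex"
  where
  "kampe_de_feriet d a b c e a' b' c' e' x y =
     (\<Sum>\<^sub>\<infinity>(m, n)\<in>UNIV. kdf_term d a b c e a' b' c' e' x y m n)"

lemma kampe_de_feriet_terminating:
  "kampe_de_feriet d a b (- of_nat N) e a' b' (- of_nat N') e' x y =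
     (\<Sum>m\<le>N. \<Sum>n\<le>N'. kdf_term d a b (- of_nat N) e a' b' (- of_nat N') e' x y m n)"
proof -
  let ?t = "\<lambda>(m, n). kdf_term d a b (- of_nat N) e a' b' (- of_nat N') e' x y m n"
  have zero: "?t p = 0" if "p \<notin> {..N} \<times> {..N'}" for p
    using that by (auto simp: kdf_term_def pochhammer_of_nat_eq_0_lemma split: prod.splits)
  have "infsum ?t UNIV = infsum ?t ({..N} \<times> {..N'})"
    by (rule infsum_cong_neutral) (use zero in auto)
  then show ?thesis
    by (simp add: kampe_de_feriet_def sum.cartesian_product)
qed

end

theory Submission imports Defs "HOL-Computational_Algebra.Formal_Power_Series" begin

text \<open>
  Write \<open>(x)\<^sub>n\<close> for \<^term>\<open>pochhammer x n\<close>, \<open>M\<close> for the second truncation index and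
  \<open>s = d - a - b\<close>. Reversing the Pochhammer symbols that contain \<open>N\<close> and \<open>M\<close>
  (lemma \<open>pochhammer_reverse_quotient\<close>) turns the quotients \<open>(-N)\<^sub>m / (1 - s - N)\<^sub>m\<close> and
  \<open>(-M)\<^sub>n / (1 - N - M)\<^sub>n\<close> into constants times \<open>(s)\<^sub>N\<^sub>-\<^sub>m / (N - m)!\<close> and
  \<open>(N)\<^sub>M\<^sub>-\<^sub>n / (M - n)!\<close>. These are coefficients of \<open>(1 - X)\<close> to the powers \<open>-s\<close> and \<open>-N\<close>,
  so both summations become Cauchy products of power series.

  For fixed \<open>n\<close>, the sum over \<open>m\<close> is the coefficient of \<open>X\<^sup>N\<close> in
  \<open>(1 - X)\<close> to the power \<open>-s\<close> times \<open>2F1(a, b; d + n; X)\<close>. Euler's transformation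
  (\<open>fps_euler_transformation\<close>), applied with lower parameter \<open>d + n\<close>, rewrites this product as
  \<open>(1 - X)\<^sup>n 2F1(d + n - a, d + n - b; d + n; X)\<close>. With
  \<open>A\<^sub>k = (d - a)\<^sub>k (d - b)\<^sub>k / (d)\<^sub>k\<close>, its coefficients combine with the factor depending on \<open>n\<close>
  to the values \<open>A\<^sub>N\<^sub>+\<^sub>n\<^sub>-\<^sub>j\<close>, and the resulting expression is again a Cauchy product: up to \<open>1 / N!\<close>
  it is the coefficient of \<open>X\<^sup>n\<close> in \<open>(1 - X)\<^sup>N G\<close>, where \<open>G\<close> has the
  coefficients \<open>A\<^sub>N\<^sub>+\<^sub>k / k!\<close> (\<open>double_sum_inner\<close>).

  The sum over \<open>n\<close> then multiplies this series by \<open>(1 - X)\<close> to the power \<open>-N\<close>. The two powers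
  cancel, and what remains is the single coefficient \<open>A\<^sub>N\<^sub>+\<^sub>M / M!\<close> of \<open>G\<close> (\<open>double_sum\<close>).
\<close>

unbundle fps_syntax

section \<open>Binomial series and Chu--Vandermonde summation\<close>

text \<open>
  By the binomial theorem this is the formal power series of \<open>(1 - X)\<close> to the power \<open>-c\<close>.
\<close>

abbreviation fps_rising :: "'a :: field_char_0 \<Rightarrow> 'a fps" where
  "fps_rising c \<equiv> fps_hypergeo [c] [] 1"

lemma pochhammer_nonzero:
  fixes d :: "'a :: field_char_0"
  assumes "d \<notin> \<int>\<^sub>\<le>\<^sub>0"
  shows "pochhammer d k \<noteq> 0"
  using assms by (auto simp: pochhammer_eq_0_iff)

lemma fps_rising_nth: "fps_rising c $ n = pochhammer c n / fact n"
  by simp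

lemma fps_rising_0: "fps_rising 0 = (1 :: 'a :: field_char_0 fps)"
  by (rule fps_ext) (simp add: fps_rising_nth pochhammer_0_left)

lemma fps_rising_add: "fps_rising (c + c') = fps_rising c * fps_rising (c' :: 'a :: field_char_0)"
proof (rule fps_ext)
  fix n
  show "fps_rising (c + c') $ n = (fps_rising c * fps_rising c') $ n"
    unfolding fps_mult_nth fps_rising_nth pochhammer_binomial_sum sum_divide_distrib
    by (intro sum.cong) (auto simp: binomial_fact atMost_atLeast0)
qed

lemma fps_rising_minus_of_nat_nth:
  "fps_rising (- of_nat n) $ j = (- 1) ^ j * (of_nat (n choose j) :: 'a :: field_char_0)"
  by (simp add: fps_rising_nth binomial_gbinomial gbinomial_pochhammer)

text \<open>
  This is the binomial theorem for Pochhammer symbols of a sum, applied to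
  \<open>x + (1 - c - n)\<close>: reflecting \<open>(1 - c - n)\<^sub>n\<^sub>-\<^sub>k\<close> gives a product that starts at \<open>c + k\<close> and
  hence completes \<open>(c)\<^sub>k\<close> to \<open>(c)\<^sub>n\<close>.
\<close>

lemma pochhammer_diff_sum:
  fixes c x :: "'a :: field_char_0"
  shows "pochhammer (c - x) n =
    (\<Sum>k\<le>n. (- 1) ^ k * of_nat (n choose k) * pochhammer x k * pochhammer (c + of_nat k) (n - k))"
proof -
  have reflect: "pochhammer (1 - c - of_nat n) (n - k) =
      (- 1) ^ (n - k) * pochhammer (c + of_nat k) (n - k)" if "k \<le> n" for k
    using that pochhammer_minus[of "c + of_nat n - 1" "n - k"]
    by (simp add: of_nat_diff algebra_simps)
  have "pochhammer (c - x) n = (- 1) ^ n * pochhammer (x + (1 - c - of_nat n)) n"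
    using pochhammer_minus[of "- (c - x)" n] by (simp add: algebra_simps flip: power_mult_distrib)
  also have "\<dots> = (\<Sum>k\<le>n. (- 1) ^ n * (of_nat (n choose k) * pochhammer x k
      * ((- 1) ^ (n - k) * pochhammer (c + of_nat k) (n - k))))"
    unfolding pochhammer_binomial_sum[of x "1 - c - of_nat n"] sum_distrib_left by (intro sum.cong) (auto simp: reflect)
  also have "\<dots> = (\<Sum>k\<le>n. (- 1) ^ k * of_nat (n choose k) * pochhammer x k
      * pochhammer (c + of_nat k) (n - k))"
  proof (intro sum.cong refl)
    fix k assume "k \<in> {..n}"
    then obtain r where "n = k + r" using le_Suc_ex by auto
    then show "(- 1) ^ n * (of_nat (n choose k) * pochhammer x k
      * ((- 1) ^ (n - k) * pochhammer (c + of_nat k) (n - k))) =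
      (- 1) ^ k * of_nat (n choose k) * pochhammer x k * pochhammer (c + of_nat k) (n - k)"
      by (simp add: power_add algebra_simps flip: power_mult_distrib)
  qed
  finally show ?thesis .
qed

lemma chu_vandermonde:
  fixes b d :: "'a :: field_char_0"
  assumes "d \<notin> \<int>\<^sub>\<le>\<^sub>0"
  shows "(\<Sum>k\<le>n. (- 1) ^ k * of_nat (n choose k) * pochhammer b k / pochhammer d k) =
    pochhammer (d - b) n / pochhammer d n"
proof -
  have nz: "pochhammer d k \<noteq> 0" for k
    using pochhammer_nonzero[OF assms] .
  show ?thesis
    unfolding pochhammer_diff_sum sum_divide_distrib
  proof (intro sum.cong refl)
    fix k assume "k \<in> {..n}"
    then have "pochhammer d n = pochhammer d k * pochhammer (d + of_nat k) (n - k)"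
      by (simp add: pochhammer_product)
    with nz[of k] nz[of n] show "(- 1) ^ k * of_nat (n choose k) * pochhammer b k / pochhammer d k =
      (- 1) ^ k * of_nat (n choose k) * pochhammer b k * pochhammer (d + of_nat k) (n - k) / pochhammer d n"
      by (auto simp: field_simps)
  qed
qed

section \<open>Euler's transformation\<close>

text \<open>
  The equality of coefficients is the Pfaff--Saalschuetz theorem. It follows from three
  Vandermonde summations. Writing \<open>d - a - b = (d - b + m) - (a + m)\<close>, the factor
  \<open>(d - a - b)\<^sub>N\<^sub>-\<^sub>m\<close> expands into terms in which \<open>(a)\<^sub>m\<close> is completed to \<open>(a)\<^sub>m\<^sub>+\<^sub>k\<close>. For fixed
  \<open>l = m + k\<close> the sum over \<open>m\<close> has only \<open>(b)\<^sub>m / (d)\<^sub>m\<close> left and produces \<open>(d - b)\<^sub>l\<close>, which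
  completes to \<open>(d - b)\<^sub>N\<close>; the remaining sum over \<open>(a)\<^sub>l / (d)\<^sub>l\<close> produces \<open>(d - a)\<^sub>N\<close>.
\<close>

lemma fps_euler_transformation:
  fixes a b d :: "'a :: field_char_0"
  assumes "d \<notin> \<int>\<^sub>\<le>\<^sub>0"
  shows "fps_hypergeo [a, b] [d] 1 * fps_rising (d - a - b) = fps_hypergeo [d - a, d - b] [d] 1"
proof (rule fps_ext)
  fix N
  have nz: "pochhammer d k \<noteq> 0" for k
    using pochhammer_nonzero[OF assms] .
  define f where "f m k r = (- 1) ^ k * pochhammer a (m + k) * pochhammer b m
      * pochhammer (d - b + of_nat (m + k)) r / (pochhammer d m * fact m * fact k * fact r)"
    for m k r
  have "(fps_hypergeo [a, b] [d] 1 * fps_rising (d - a - b)) $ N =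
      (\<Sum>m=0..N. \<Sum>k=0..N-m. f m k (N - m - k))"
    unfolding fps_mult_nth
  proof (intro sum.cong refl)
    fix m assume "m \<in> {0..N}"
    have "pochhammer (d - a - b) (N - m) =
        pochhammer ((d - b + of_nat m) - (a + of_nat m)) (N - m)"
      by (simp add: algebra_simps)
    also have "\<dots> = (\<Sum>k=0..N-m. (- 1) ^ k * of_nat ((N - m) choose k)
        * pochhammer (a + of_nat m) k * pochhammer (d - b + of_nat (m + k)) (N - m - k))"
      unfolding pochhammer_diff_sum by (simp add: add_ac atMost_atLeast0)
    finally have "fps_hypergeo [a, b] [d] 1 $ m * fps_rising (d - a - b) $ (N - m) =
        (\<Sum>k=0..N-m. pochhammer a m * pochhammer b m / (pochhammer d m * fact m)
        * ((- 1) ^ k * of_nat ((N - m) choose k) * pochhammer (a + of_nat m) k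
        * pochhammer (d - b + of_nat (m + k)) (N - m - k)) / fact (N - m))"
      by (simp add: sum_distrib_left sum_divide_distrib)
    also have "\<dots> = (\<Sum>k=0..N-m. f m k (N - m - k))"
    proof (intro sum.cong refl)
      fix k assume "k \<in> {0..N-m}"
      then show "pochhammer a m * pochhammer b m / (pochhammer d m * fact m)
          * ((- 1) ^ k * of_nat ((N - m) choose k) * pochhammer (a + of_nat m) k
          * pochhammer (d - b + of_nat (m + k)) (N - m - k)) / fact (N - m) = f m k (N - m - k)"
        unfolding f_def pochhammer_product'[of a m k] by (simp add: binomial_fact mult_ac)
    qed
    finally show "fps_hypergeo [a, b] [d] 1 $ m * fps_rising (d - a - b) $ (N - m) =
        (\<Sum>k=0..N-m. f m k (N - m - k))" .
  qed
  also have "\<dots> = (\<Sum>l=0..N. \<Sum>m=0..l. f m (l - m) (N - l))"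
    by (rule fps_mult_assoc_lemma[symmetric])
  also have "\<dots> = (\<Sum>l=0..N. pochhammer (d - b) N / fact N
      * ((- 1) ^ l * of_nat (N choose l) * pochhammer a l / pochhammer d l))"
  proof (intro sum.cong refl)
    fix l assume l: "l \<in> {0..N}"
    have "(\<Sum>m=0..l. f m (l - m) (N - l)) =
        (\<Sum>m=0..l. (- 1) ^ l * pochhammer a l * pochhammer (d - b + of_nat l) (N - l)
          / (fact l * fact (N - l))
          * ((- 1) ^ m * of_nat (l choose m) * pochhammer b m / pochhammer d m))"
    proof (intro sum.cong refl)
      fix m assume "m \<in> {0..l}"
      then obtain r where "l = m + r" using le_Suc_ex by auto
      then show "f m (l - m) (N - l) =
          (- 1) ^ l * pochhammer a l * pochhammer (d - b + of_nat l) (N - l)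
          / (fact l * fact (N - l))
          * ((- 1) ^ m * of_nat (l choose m) * pochhammer b m / pochhammer d m)"
        using nz[of m]
        by (simp add: f_def binomial_fact power_add field_simps flip: power_mult_distrib)
    qed
    also have "\<dots> = (- 1) ^ l * pochhammer a l * pochhammer (d - b + of_nat l) (N - l)
          / (fact l * fact (N - l)) * (pochhammer (d - b) l / pochhammer d l)"
      unfolding sum_distrib_left[symmetric]
        chu_vandermonde[OF assms, of l b, unfolded atMost_atLeast0] ..
    also have "\<dots> = pochhammer (d - b) N / fact N
      * ((- 1) ^ l * of_nat (N choose l) * pochhammer a l / pochhammer d l)"
      using l nz[of l] by (simp add: binomial_fact pochhammer_product[of l N] field_simps)
    finally show "(\<Sum>m=0..l. f m (l - m) (N - l)) = pochhammer (d - b) N / fact N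
      * ((- 1) ^ l * of_nat (N choose l) * pochhammer a l / pochhammer d l)" .
  qed
  also have "\<dots> = fps_hypergeo [d - a, d - b] [d] 1 $ N"
    unfolding sum_distrib_left[symmetric]
      chu_vandermonde[OF assms, of N a, unfolded atMost_atLeast0]
    by (simp add: mult_ac)
  finally show "(fps_hypergeo [a, b] [d] 1 * fps_rising (d - a - b)) $ N =
    fps_hypergeo [d - a, d - b] [d] 1 $ N" .
qed


section \<open>The double sum as a coefficient of a power series\<close>

text \<open>
  The point of this form is that \<open>n\<close> becomes the index of a coefficient. After Euler's
  transformation with \<open>d + n\<close>, the \<open>j\<close>-th term contains
  \<open>(n choose j) / (n! (N - j)!) = 1 / (j! (n - j)! (N - j)!)\<close>. This is symmetric in \<open>n\<close> and \<open>N\<close>,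
  and so is \<open>A\<^sub>N\<^sub>+\<^sub>n\<^sub>-\<^sub>j\<close>; hence the roles of \<open>n\<close> and \<open>N\<close> can be exchanged, and the coefficient of \<open>X\<^sup>N\<close>
  in a series depending on \<open>n\<close> becomes the coefficient of \<open>X\<^sup>n\<close> in a series depending on \<open>N\<close>.
\<close>

lemma double_sum_inner:
  fixes a b d :: "'a :: field_char_0" and N n :: nat
  assumes d: "d \<notin> \<int>\<^sub>\<le>\<^sub>0"
  defines "A \<equiv> (\<lambda>k. pochhammer (d - a) k * pochhammer (d - b) k / pochhammer d k)"
  shows "pochhammer (d - a) n * pochhammer (d - b) n / fact n *
      (\<Sum>m\<le>N. pochhammer a m * pochhammer b m / (fact m * pochhammer d (m + n))
        * (pochhammer (d - a - b) (N - m) / fact (N - m)))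
    = (fps_rising (- of_nat N) * Abs_fps (\<lambda>k. A (N + k) / fact k)) $ n / fact N"
proof -
  define D where "D = d + of_nat n"
  have D: "D \<notin> \<int>\<^sub>\<le>\<^sub>0"
  proof
    assume "D \<in> \<int>\<^sub>\<le>\<^sub>0"
    then have "D - of_nat n \<in> \<int>\<^sub>\<le>\<^sub>0"
      by (rule nonpos_Ints_diff_Nats) simp
    with d show False by (simp add: D_def)
  qed
  have d_split: "pochhammer d (m + n) = pochhammer d n * pochhammer D m" for m
    using pochhammer_product'[of d n m] by (simp add: D_def add.commute)
  have A_split: "A (n + k) = A n * (pochhammer (D - a) k * pochhammer (D - b) k / pochhammer D k)" for k
    unfolding A_def pochhammer_product' by (simp add: D_def algebra_simps)
  have "fps_hypergeo [a, b] [D] 1 * fps_rising (d - a - b) =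
      fps_hypergeo [a, b] [D] 1 * fps_rising ((D - a - b) + (- of_nat n))"
    by (simp add: D_def algebra_simps)
  also have "\<dots> = fps_rising (- of_nat n) * fps_hypergeo [D - a, D - b] [D] 1"
    unfolding fps_rising_add fps_euler_transformation[OF D, symmetric] by (simp only: mult_ac)
  finally have euler: "fps_hypergeo [a, b] [D] 1 * fps_rising (d - a - b) =
      fps_rising (- of_nat n) * fps_hypergeo [D - a, D - b] [D] 1" .
  have "pochhammer (d - a) n * pochhammer (d - b) n / fact n *
      (\<Sum>m\<le>N. pochhammer a m * pochhammer b m / (fact m * pochhammer d (m + n))
        * (pochhammer (d - a - b) (N - m) / fact (N - m)))
    = A n / fact n * (fps_hypergeo [a, b] [D] 1 * fps_rising (d - a - b)) $ N"
    unfolding fps_mult_nth sum_distrib_left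
    by (intro sum.cong) (auto simp: A_def d_split field_simps atMost_atLeast0)
  also have "\<dots> = A n / fact n * (fps_rising (- of_nat n) * fps_hypergeo [D - a, D - b] [D] 1) $ N"
    unfolding euler ..
  also have "\<dots> = (\<Sum>j=0..N. (- 1) ^ j * (of_nat (n choose j) / fact n) * A (n + (N - j)) / fact (N - j))"
    unfolding fps_mult_nth sum_distrib_left fps_rising_minus_of_nat_nth A_split
    by (intro sum.cong) (auto simp: field_simps)
  also have "\<dots> = (\<Sum>j=0..n. (- 1) ^ j * (of_nat (N choose j) / fact N) * A (N + (n - j)) / fact (n - j))"
  \<comment> \<open>Both sums effectively run over \<open>j \<le> min n N\<close>, as the binomial coefficients vanish beyond.\<close>
  proof (rule sum.mono_neutral_cong)
    fix j assume "j \<in> {0..N} \<inter> {0..n}"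
    moreover from this have "n + (N - j) = N + (n - j)" by auto
    ultimately show "(- 1) ^ j * (of_nat (n choose j) / fact n) * A (n + (N - j)) / fact (N - j) =
      (- 1) ^ j * (of_nat (N choose j) / fact N) * A (N + (n - j)) / fact (n - j)"
      by (simp add: binomial_fact field_simps)
  qed auto
  also have "\<dots> = (fps_rising (- of_nat N) * Abs_fps (\<lambda>k. A (N + k) / fact k)) $ n / fact N"
    unfolding fps_mult_nth sum_divide_distrib fps_rising_minus_of_nat_nth
    by (intro sum.cong) auto
  finally show ?thesis .
qed

text \<open>
  The weight \<open>(N)\<^sub>M\<^sub>-\<^sub>n / (M - n)!\<close> is exactly the one that inverts the factor \<open>(1 - X)\<^sup>N\<close> of the
  preceding lemma.
\<close>

lemma double_sum:
  fixes a b d :: "'a :: field_char_0" and N M :: nat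
  assumes d: "d \<notin> \<int>\<^sub>\<le>\<^sub>0"
  shows "(\<Sum>m\<le>N. \<Sum>n\<le>M.
      pochhammer a m * pochhammer b m / (fact m * pochhammer d (m + n))
      * (pochhammer (d - a - b) (N - m) / fact (N - m))
      * (pochhammer (d - a) n * pochhammer (d - b) n / fact n)
      * (pochhammer (of_nat N) (M - n) / fact (M - n))) =
    pochhammer (d - a) (N + M) * pochhammer (d - b) (N + M)
      / (pochhammer d (N + M) * fact N * fact M)"
    (is "?lhs = _")
proof -
  define A where "A k = pochhammer (d - a) k * pochhammer (d - b) k / pochhammer d k" for k
  define G where "G = Abs_fps (\<lambda>k. A (N + k) / fact k)"
  have "?lhs = (\<Sum>n\<le>M. (pochhammer (d - a) n * pochhammer (d - b) n / fact n *
      (\<Sum>m\<le>N. pochhammer a m * pochhammer b m / (fact m * pochhammer d (m + n))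
        * (pochhammer (d - a - b) (N - m) / fact (N - m))))
      * (pochhammer (of_nat N) (M - n) / fact (M - n)))"
    by (subst sum.swap) (simp add: sum_distrib_left sum_distrib_right mult_ac)
  also have "\<dots> = (\<Sum>n=0..M. (fps_rising (- of_nat N) * G) $ n * fps_rising (of_nat N) $ (M - n)) / fact N"
    unfolding double_sum_inner[OF d] unfolding G_def A_def fps_rising_nth sum_divide_distrib atMost_atLeast0
    by (simp add: mult_ac)
  also have "\<dots> = (fps_rising (- of_nat N + of_nat N) * G) $ M / fact N"
    unfolding fps_rising_add fps_mult_nth[symmetric] by (simp only: mult_ac)
  also have "\<dots> = A (N + M) / (fact N * fact M)"
    by (simp add: fps_rising_0 G_def)
  finally show ?thesis by (simp add: A_def mult_ac)
qed

section \<open>Reversal of the terminating parameters\<close>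

lemma pochhammer_reverse:
  fixes s :: "'a :: field_char_0"
  assumes "m \<le> N"
  shows "pochhammer (1 - s - of_nat N) m * pochhammer s (N - m) = (- 1) ^ m * pochhammer s N"
  using assms pochhammer_minus[of "s + of_nat N - 1" m] pochhammer_product[of "N - m" N s]
  by (simp add: of_nat_diff algebra_simps)

text \<open>
  The numerator \<open>(-N)\<^sub>m\<close> is the case \<open>s = 1\<close> of the same reversal, so the signs cancel. The
  hypothesis is on \<open>(s)\<^sub>N\<close> and not on the parameter \<open>1 - s - N\<close>, because that parameter may be a
  nonpositive integer: for the summation over \<open>n\<close> it is \<open>1 - N - M\<close>.
\<close>

lemma pochhammer_reverse_quotient:
  fixes s :: "'a :: field_char_0"
  assumes "m \<le> N" and "pochhammer s N \<noteq> 0"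
  shows "pochhammer (- of_nat N) m / pochhammer (1 - s - of_nat N) m =
    fact N / pochhammer s N * (pochhammer s (N - m) / fact (N - m))"
proof -
  have s: "pochhammer (1 - s - of_nat N) m * pochhammer s (N - m) = (- 1) ^ m * pochhammer s N"
    by (rule pochhammer_reverse[OF assms(1)])
  with assms(2) have nz: "pochhammer s (N - m) \<noteq> 0"
    by auto
  have "pochhammer (- of_nat N) m = (- 1) ^ m * fact N / (fact (N - m) :: 'a)"
    using pochhammer_reverse[OF assms(1), of "1 :: 'a"] by (simp add: eq_divide_eq flip: pochhammer_fact)
  moreover have "pochhammer (1 - s - of_nat N) m = (- 1) ^ m * pochhammer s N / pochhammer s (N - m)"
    using s nz by (simp add: eq_divide_eq)
  ultimately show ?thesis
    by simp
qed

theorem mainTheorem10: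
  fixes N N' :: nat and a b d :: complex
  assumes "N > 0" and "N' > 0"
    and "d \<notin> \<int>\<^sub>\<le>\<^sub>0"
    and "1 + a + b - of_nat N - d \<notin> \<int>\<^sub>\<le>\<^sub>0"
  shows "kampe_de_feriet d
           a b (- of_nat N) (1 + a + b - of_nat N - d)
           (d - a) (d - b) (- of_nat N') (1 - of_nat N - of_nat N')
           1 1 =
         (pochhammer (d - a) (N + N') * pochhammer (d - b) (N + N')) /
         (pochhammer d (N + N') * pochhammer (d - a - b) N * pochhammer (of_nat N) N')"
proof -
  define s where "s = d - a - b"
  define c where "c = fact N * fact N' / (pochhammer s N * pochhammer (of_nat N) N' :: complex)"
  have e: "1 + a + b - of_nat N - d = 1 - s - of_nat N"
    by (simp add: s_def)
  have "pochhammer (1 - s - of_nat N) N \<noteq> 0"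
    using pochhammer_nonzero[OF assms(4)] by (simp only: e not_False_eq_True)
  then have s: "pochhammer s N \<noteq> 0"
    using pochhammer_reverse[of N N s] by auto
  have N: "pochhammer (of_nat N :: complex) N' \<noteq> 0"
    using assms(1) by (intro pochhammer_nonzero) (simp add: of_nat_in_nonpos_Ints_iff)
  have "kdf_term d a b (- of_nat N) (1 - s - of_nat N)
      (d - a) (d - b) (- of_nat N') (1 - of_nat N - of_nat N') 1 1 m n =
    c * (pochhammer a m * pochhammer b m / (fact m * pochhammer d (m + n))
      * (pochhammer s (N - m) / fact (N - m))
      * (pochhammer (d - a) n * pochhammer (d - b) n / fact n)
      * (pochhammer (of_nat N) (N' - n) / fact (N' - n)))" if "m \<le> N" "n \<le> N'" for m n
  proof -
    have "kdf_term d a b (- of_nat N) (1 - s - of_nat N)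
        (d - a) (d - b) (- of_nat N') (1 - of_nat N - of_nat N') 1 1 m n =
      pochhammer a m * pochhammer b m / (fact m * pochhammer d (m + n))
      * (pochhammer (- of_nat N) m / pochhammer (1 - s - of_nat N) m)
      * (pochhammer (d - a) n * pochhammer (d - b) n / fact n)
      * (pochhammer (- of_nat N') n / pochhammer (1 - of_nat N - of_nat N') n)"
      by (simp add: kdf_term_def mult_ac)
    then show ?thesis
      unfolding pochhammer_reverse_quotient[OF that(1) s] pochhammer_reverse_quotient[OF that(2) N] c_def
      by (simp add: mult_ac)
  qed
  then have "kampe_de_feriet d a b (- of_nat N) (1 - s - of_nat N)
      (d - a) (d - b) (- of_nat N') (1 - of_nat N - of_nat N') 1 1 =
    c * (\<Sum>m\<le>N. \<Sum>n\<le>N'. pochhammer a m * pochhammer b m / (fact m * pochhammer d (m + n))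
      * (pochhammer s (N - m) / fact (N - m))
      * (pochhammer (d - a) n * pochhammer (d - b) n / fact n)
      * (pochhammer (of_nat N) (N' - n) / fact (N' - n)))"
    unfolding kampe_de_feriet_terminating sum_distrib_left by (intro sum.cong refl) auto
  also have "\<dots> = pochhammer (d - a) (N + N') * pochhammer (d - b) (N + N') /
         (pochhammer d (N + N') * pochhammer s N * pochhammer (of_nat N) N')"
    unfolding s_def double_sum[OF assms(3)] by (simp add: c_def s_def)
  finally show ?thesis
    unfolding e s_def .
qed

end
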